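(* For every odd integer $n\geq 9$, there exists a doubly Eulerian graph of order $n$ which is regular of degree $n-3$ (an edge-maximal doubly Eulerian graph of order $n$).
   Context: All graphs are finite, simple and connected. An Eulerian circuit is a closed trail traversing every edge exactly once. Let $G$ be Eulerian with $m$ edges and $u$ a vertex. Two Eulerian circuits $u,v_1,\ldots,v_{m-1},u$ and $u,w_1,\ldots,w_{m-1},u$ are avoiding if for every $1\le i\le m-1$, $v_i\neq w_i$ and $v_i$ is not adjacent to $w_i$. $G$ is doubly Eulerian if for every vertex $u$ there is a pair of avoiding Eulerian circuits starting and ending at $u$. For odd $n$, a doubly Eulerian graph of order $n$ is edge-maximal if it is regular of degree $n-3$ (the maximum possible). *)

theory Defs
  imports "Graph_Theory.Graph_Theory"
begin

text \<open>
  A finite simple graph is a \<open>pair_graph\<close>: a finite, loop-free, symmetric set of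
  ordered pairs. Each undirected edge is thus represented by two opposite arcs, so edges have to
  be counted, and traversed, as unordered pairs.
\<close>

definition uedge :: "'a \<times> 'a \<Rightarrow> 'a set" where
  "uedge e = {fst e, snd e}"

definition uedges :: "'a pair_pre_digraph \<Rightarrow> 'a set set" where
  "uedges G = uedge ` parcs G"

definition closed_trail :: "'a pair_pre_digraph \<Rightarrow> 'a \<Rightarrow> 'a vwalk \<Rightarrow> bool" where
  "closed_trail G u p \<longleftrightarrow>
     vwalk p G \<and> hd p = u \<and> last p = u \<and> distinct (map uedge (vwalk_arcs p))"

text \<open>
  A circuit is the list of all its vertices, the initial vertex being repeated at the end:
  \<open>p ! 0 = u\<close> and \<open>p ! m = u\<close>, where \<open>m\<close> is the number of edges.
\<close>

definition eulerian_circuit :: "'a pair_pre_digraph \<Rightarrow> 'a \<Rightarrow> 'a vwalk \<Rightarrow> bool" where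
  "eulerian_circuit G u p \<longleftrightarrow>
     closed_trail G u p \<and> set (map uedge (vwalk_arcs p)) = uedges G"

lemma eulerian_circuit_length:
  assumes "eulerian_circuit G u p"
  shows "length p = card (uedges G) + 1"
proof -
  have "p \<noteq> []" and d: "distinct (map uedge (vwalk_arcs p))"
    and s: "set (map uedge (vwalk_arcs p)) = uedges G"
    using assms by (auto simp: eulerian_circuit_def closed_trail_def vwalk_def)
  have "card (uedges G) = length (map uedge (vwalk_arcs p))"
    using distinct_card[OF d] unfolding s .
  also have "\<dots> = length p - 1"
    using vwalk_length_simp[of p] unfolding vwalk_length_def by simp
  finally show ?thesis
    using \<open>p \<noteq> []\<close> by (cases p) auto
qed

definition eulerian :: "'a pair_pre_digraph \<Rightarrow> bool" where
  "eulerian G \<longleftrightarrow>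
     pair_graph G \<and> connected (with_proj G) \<and> (\<exists>u\<in>pverts G. \<exists>p. eulerian_circuit G u p)"

definition avoiding :: "'a pair_pre_digraph \<Rightarrow> 'a vwalk \<Rightarrow> 'a vwalk \<Rightarrow> bool" where
  "avoiding G p q \<longleftrightarrow>
     (\<forall>i\<in>{1..card (uedges G) - 1}. p ! i \<noteq> q ! i \<and> (p ! i, q ! i) \<notin> parcs G)"

definition doubly_eulerian :: "'a pair_pre_digraph \<Rightarrow> bool" where
  "doubly_eulerian G \<longleftrightarrow>
     eulerian G \<and>
     (\<forall>u\<in>pverts G. \<exists>p q. eulerian_circuit G u p \<and> eulerian_circuit G u q \<and> avoiding G p q)"

definition regular_of_degree :: "'a pair_pre_digraph \<Rightarrow> nat \<Rightarrow> bool" where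
  "regular_of_degree G k \<longleftrightarrow> (\<forall>v\<in>pverts G. out_degree (with_proj G) v = k)"

end

(*
  The graph is the complement of the disjoint union of three odd cycles: two triangles and a cycle
  of length n - 6. Let sigma rotate each cycle by one step. If one circuit always stays one
  rotation step ahead of the other, the two are never equal or adjacent, but they have no common
  starting point c. To create one, let K be the cycle of c and choose a permutation rho of K that
  fixes c and moves every other vertex to one of its two neighbours on the cycle; it exists because
  K is odd. For two vertices y of another cycle, the edges xy with x in K are shadowed by
  (rho x)(sigma y) instead of (sigma x)(sigma y). This still permutes the edge set.

  The pairs (position of the first circuit, position of the second one) are the vertices of an
  auxiliary graph whose edges correspond to the edges of G via either projection. It is connected
  with even degrees, and (c, c) has degree 2. An Eulerian circuit of it starting at (c, c) projects
  to the two avoiding circuits.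
*)
theory Submission
  imports Defs
begin

section \<open>Eulerian circuits in finite sets of undirected edges\<close>

abbreviation walk_edges :: "'a list \<Rightarrow> 'a set list" where
  "walk_edges p \<equiv> map uedge (vwalk_arcs p)"

definition trail_in :: "'a set set \<Rightarrow> 'a list \<Rightarrow> bool" where
  "trail_in F p \<longleftrightarrow> p \<noteq> [] \<and> distinct (walk_edges p) \<and> set (walk_edges p) \<subseteq> F"

lemma walk_edges_append:
  assumes "p \<noteq> []" "q \<noteq> []" "last p = hd q"
  shows "walk_edges (p @ tl q) = walk_edges p @ walk_edges q"
  using assms
proof (induction p rule: vwalk_arcs.induct)
  case (2 x)
  then show ?case by (cases q) auto
qed auto

lemma walk_edges_snoc:
  assumes "p \<noteq> []"
  shows "walk_edges (p @ [x]) = walk_edges p @ [{last p, x}]"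
  using walk_edges_append[OF assms, of "[last p, x]"] by (simp add: uedge_def)

lemma walk_edges_nth:
  "Suc i < length p \<Longrightarrow> walk_edges p ! i = {p ! i, p ! Suc i}"
  by (induction p arbitrary: i rule: vwalk_arcs.induct) (auto simp: uedge_def nth_Cons split: nat.splits)

lemma length_walk_edges: "length (walk_edges p) = length p - 1"
  using vwalk_length_simp[of p] unfolding vwalk_length_def by simp

lemma Union_walk_edges: "\<Union>(set (walk_edges p)) \<subseteq> set p"
  by (induction p rule: vwalk_arcs.induct) (auto simp: uedge_def)

lemma subset_Union_walk_edges:
  "length p \<ge> 2 \<Longrightarrow> set p \<subseteq> \<Union>(set (walk_edges p))"
proof (induction p rule: vwalk_arcs.induct)
  case (3 x y xs)
  then show ?case by (cases xs) (auto simp: uedge_def)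
qed auto

text \<open>Each passage through \<open>x\<close> inside the walk uses two edges and each end of the
  walk at \<open>x\<close> uses one; \<open>card e = 2\<close> rules out loops.\<close>

lemma even_incidences_iff:
  assumes "p \<noteq> []" "\<forall>e\<in>set (walk_edges p). card e = 2"
  shows "even (length (filter (\<lambda>e. x \<in> e) (walk_edges p))) \<longleftrightarrow> (x = hd p \<longleftrightarrow> x = last p)"
  using assms
proof (induction p rule: vwalk_arcs.induct)
  case (3 a b xs)
  then have "a \<noteq> b" by (auto simp: uedge_def)
  with 3 show ?case by (auto simp: uedge_def)
qed auto

text \<open>Cutting a closed trail at an occurrence of \<open>x\<close> and swapping the two pieces
  only permutes its edges; \<open>tl\<close> drops the duplicated junction vertex.\<close>

lemma closed_trail_rotate:
  assumes "trail_in F p" "hd p = last p" "x \<in> set p"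
  obtains q where "trail_in F q" "hd q = x" "last q = x"
    "set (walk_edges q) = set (walk_edges p)" "length q = length p"
proof -
  obtain p1 p2 where p: "p = p1 @ x # p2"
    using \<open>x \<in> set p\<close> by (meson split_list)
  let ?q = "(x # p2) @ tl (p1 @ [x])"
  have 1: "walk_edges p = walk_edges (p1 @ [x]) @ walk_edges (x # p2)"
    using walk_edges_append[of "p1 @ [x]" "x # p2"] by (simp add: p)
  have 2: "walk_edges ?q = walk_edges (x # p2) @ walk_edges (p1 @ [x])"
    by (rule walk_edges_append) (use assms(2) in \<open>auto simp: p hd_append split: if_splits\<close>)
  show thesis
  proof
    show "trail_in F ?q"
      using assms(1) unfolding trail_in_def 1 2 by auto
    show "last ?q = x"
      using assms(2) by (cases p1) (auto simp: p)
    show "set (walk_edges ?q) = set (walk_edges p)"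
      unfolding 1 2 by auto
    show "length ?q = length p" by (simp add: p)
  qed simp
qed

text \<open>Euler's argument with a longest trail: parity forces it to be closed, and if it missed
  an edge that meets it, a rotation of it could be extended. The hypothesis \<open>conn\<close>
  expresses connectivity through edges alone.\<close>

theorem even_degree_closed_trail:
  fixes F :: "'a set set"
  assumes fin: "finite F"
    and edges: "\<And>e. e \<in> F \<Longrightarrow> card e = 2"
    and even: "\<And>x. even (card {e \<in> F. x \<in> e})"
    and conn: "\<And>A. A \<subseteq> F \<Longrightarrow> A \<noteq> {} \<Longrightarrow>
      (\<And>e e'. e \<in> A \<Longrightarrow> e' \<in> F \<Longrightarrow> e \<inter> e' \<noteq> {} \<Longrightarrow> e' \<in> A) \<Longrightarrow> F \<subseteq> A"
    and s: "s \<in> \<Union>F"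
  obtains p where "trail_in F p" "hd p = s" "last p = s" "set (walk_edges p) = F"
proof -
  have bound: "length p \<le> Suc (card F)" if "trail_in F p" for p
  proof -
    have "length (walk_edges p) \<le> card F"
      using that fin unfolding trail_in_def by (metis card_mono distinct_card)
    then show ?thesis unfolding length_walk_edges by simp
  qed
  have "trail_in F [s]" by (simp add: trail_in_def)
  then obtain p where p: "trail_in F p"
    and max: "\<And>q. trail_in F q \<Longrightarrow> length q \<le> length p"
    using ex_has_greatest_nat[of "trail_in F" "[s]" length "Suc (Suc (card F))"] bound
    by (auto simp: less_Suc_eq_le)
  have pne: "p \<noteq> []" using p by (simp add: trail_in_def)
  \<comment> \<open>Stated for every trail as long as \<open>p\<close>, because it is also applied
    to rotations of \<open>p\<close>.\<close>
  have stuck: "e \<in> set (walk_edges q)"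
    if "trail_in F q" "length q = length p" "e \<in> F" "last q \<in> e" for q e
  proof (rule ccontr)
    assume new: "e \<notin> set (walk_edges q)"
    obtain x where e: "e = {last q, x}"
      using edges[OF \<open>e \<in> F\<close>] \<open>last q \<in> e\<close> by (auto simp: card_2_iff)
    have "q \<noteq> []" using that by (simp add: trail_in_def)
    have "trail_in F (q @ [x])"
      using that new e unfolding trail_in_def walk_edges_snoc[OF \<open>q \<noteq> []\<close>] by simp
    from max[OF this] that(2) show False by simp
  qed
  have closed: "hd p = last p"
  proof (rule ccontr)
    assume neq: "hd p \<noteq> last p"
    \<comment> \<open>Every edge at the end of \<open>p\<close> already lies on \<open>p\<close>, so
      the degree there is the number of incidences along \<open>p\<close>, which is odd when the
      ends differ.\<close>
    have "{e \<in> F. last p \<in> e} = set (filter (\<lambda>e. last p \<in> e) (walk_edges p))"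
      using stuck[OF p] p unfolding trail_in_def by auto
    then have "card {e \<in> F. last p \<in> e} = length (filter (\<lambda>e. last p \<in> e) (walk_edges p))"
      using p unfolding trail_in_def by (metis distinct_card distinct_filter)
    moreover have "\<forall>e\<in>set (walk_edges p). card e = 2"
      using p edges unfolding trail_in_def by blast
    ultimately show False
      using even[of "last p"] even_incidences_iff[OF pne, of "last p"] neq by auto
  qed
  have "length p \<ge> 2"
  proof -
    obtain e where e: "e \<in> F" "s \<in> e" using s by auto
    then obtain x where "e = {s, x}" using edges[of e] by (auto simp: card_2_iff)
    then have "trail_in F [s, x]" using e by (simp add: trail_in_def uedge_def)
    from max[OF this] show ?thesis by simp
  qed
  have "F \<subseteq> set (walk_edges p)"
  proof (rule conn)
    show "set (walk_edges p) \<subseteq> F" using p by (simp add: trail_in_def)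
    show "set (walk_edges p) \<noteq> {}"
      using \<open>length p \<ge> 2\<close> length_walk_edges[of p] by force
    fix e e' assume e: "e \<in> set (walk_edges p)" "e' \<in> F" "e \<inter> e' \<noteq> {}"
    then obtain x where x: "x \<in> e" "x \<in> e'" by auto
    then have "x \<in> set p" using Union_walk_edges[of p] e by auto
    from closed_trail_rotate[OF p closed this] obtain q where q: "trail_in F q" "last q = x"
      "set (walk_edges q) = set (walk_edges p)" "length q = length p" by metis
    show "e' \<in> set (walk_edges p)"
      using stuck[OF q(1,4) e(2)] x q by auto
  qed
  then have all: "set (walk_edges p) = F" using p by (auto simp: trail_in_def)
  with s have "s \<in> set p" using Union_walk_edges[of p] by auto
  from closed_trail_rotate[OF p closed this] all that show thesis by metis
qed

lemma image_pairs: "{f x y | x y. P x y} = (\<lambda>(x, y). f x y) ` {(x, y). P x y}"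
  by (auto simp: image_def)

section \<open>Complements of unions of cycles\<close>

definition cycle_complement :: "'a set \<Rightarrow> ('a \<Rightarrow> 'a) \<Rightarrow> 'a pair_pre_digraph" where
  "cycle_complement V \<sigma> =
     \<lparr>pverts = V, parcs = {(x, y) \<in> V \<times> V. x \<noteq> y \<and> y \<noteq> \<sigma> x \<and> x \<noteq> \<sigma> y}\<rparr>"

text \<open>The last two assumptions exclude cycles of length one and two, so every vertex has two
  distinct neighbours on its cycle.\<close>

locale cycle_union =
  fixes V :: "'a set" and \<sigma> :: "'a \<Rightarrow> 'a"
  assumes finite_V: "finite V"
    and inj_\<sigma>: "inj_on \<sigma> V"
    and \<sigma>_V: "\<sigma> ` V = V"
    and \<sigma>_neq: "x \<in> V \<Longrightarrow> \<sigma> x \<noteq> x"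
    and \<sigma>_\<sigma>_neq: "x \<in> V \<Longrightarrow> \<sigma> (\<sigma> x) \<noteq> x"
begin

section \<open>Adjacency and degrees in the complement\<close>

abbreviation G :: "'a pair_pre_digraph" where
  "G \<equiv> cycle_complement V \<sigma>"

definition adj :: "'a \<Rightarrow> 'a \<Rightarrow> bool" where
  "adj x y \<longleftrightarrow> x \<in> V \<and> y \<in> V \<and> x \<noteq> y \<and> y \<noteq> \<sigma> x \<and> x \<noteq> \<sigma> y"

lemma pverts_G [simp]: "pverts G = V"
  by (simp add: cycle_complement_def)

lemma parcs_G: "parcs G = {(x, y). adj x y}"
  by (auto simp: cycle_complement_def adj_def)

lemma adj_sym: "adj x y \<Longrightarrow> adj y x"
  by (auto simp: adj_def)

lemma adj_in_V: "adj x y \<Longrightarrow> x \<in> V" "adj x y \<Longrightarrow> y \<in> V"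
  by (auto simp: adj_def)

lemma \<sigma>_in_V: "x \<in> V \<Longrightarrow> \<sigma> x \<in> V"
  using imageI[of x V \<sigma>] unfolding \<sigma>_V .

lemma \<sigma>_preimage:
  assumes "x \<in> V"
  obtains y where "y \<in> V" "\<sigma> y = x"
proof -
  have "x \<in> \<sigma> ` V" using assms unfolding \<sigma>_V .
  then show thesis using that by blast
qed

lemma \<sigma>_eq_iff: "x \<in> V \<Longrightarrow> y \<in> V \<Longrightarrow> \<sigma> x = \<sigma> y \<longleftrightarrow> x = y"
  using inj_\<sigma> by (auto dest: inj_onD)

lemma adj_\<sigma>_iff: "x \<in> V \<Longrightarrow> y \<in> V \<Longrightarrow> adj (\<sigma> x) (\<sigma> y) \<longleftrightarrow> adj x y"
  by (auto simp: adj_def \<sigma>_in_V \<sigma>_eq_iff)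

lemma uedges_G: "uedges G = {{x, y} | x y. adj x y}"
proof -
  have "uedges G = (\<lambda>(x, y). {x, y}) ` {(x, y). adj x y}"
    unfolding uedges_def parcs_G by (rule image_cong) (auto simp: uedge_def)
  then show ?thesis unfolding image_pairs .
qed

lemma pair_graph_G: "pair_graph G"
proof
  show "finite (parcs G)"
    by (rule finite_subset[of _ "V \<times> V"]) (auto simp: parcs_G adj_def finite_V)
  show "symmetric (with_proj G)"
    by (auto simp: symmetric_def parcs_G sym_def adj_sym)
  show "finite (pverts G)" by (simp add: finite_V)
qed (auto simp: parcs_G adj_def)

lemma card_neighbours:
  assumes "x \<in> V"
  shows "card {y. adj x y} = card V - 3"
proof -
  \<comment> \<open>\<open>z\<close> is the predecessor of \<open>x\<close>, so the excluded
    vertices are \<open>x\<close> and its two cycle neighbours.\<close>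
  obtain z where z: "z \<in> V" "\<sigma> z = x" by (rule \<sigma>_preimage[OF assms])
  have "x = \<sigma> y \<longleftrightarrow> y = z" if "y \<in> V" for y
    using \<sigma>_eq_iff[OF that z(1)] z(2) by metis
  then have "{y. adj x y} = V - {x, \<sigma> x, z}"
    using assms unfolding adj_def by blast
  moreover have "card {x, \<sigma> x, z} = 3"
    using \<sigma>_neq[of x] \<sigma>_neq[of z] \<sigma>_\<sigma>_neq[of z] z assms by auto
  ultimately show ?thesis
    using assms z(1) \<sigma>_in_V[OF assms] by (simp add: card_Diff_subset)
qed

lemma regular_G: "regular_of_degree G (card V - 3)"
proof -
  have "out_degree (with_proj G) x = card V - 3" if "x \<in> V" for x
  proof -
    have "out_arcs (with_proj G) x = Pair x ` {y. adj x y}"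
      by (auto simp: out_arcs_def parcs_G)
    then show ?thesis
      using card_neighbours[OF that] by (simp add: out_degree_def card_image inj_on_def)
  qed
  then show ?thesis by (simp add: regular_of_degree_def)
qed

end

text \<open>
  The second circuit shadows the first one: while the first runs along the edge between \<open>x\<close> and
  \<open>y\<close>, the second runs between \<open>\<sigma> x\<close> and \<open>\<sigma> y\<close>, except that \<open>\<rho> x\<close> replaces \<open>\<sigma> x\<close> if
  \<open>y \<in> Y\<close>. Thus both circuits are at \<open>c\<close> exactly when the first one moves between \<open>c\<close> and \<open>Y\<close>.
\<close>

locale seam = cycle_union V \<sigma> for V :: "'a set" and \<sigma> +
  fixes K L M :: "'a set" and \<rho> :: "'a \<Rightarrow> 'a" and c m :: 'a and Y :: "'a set"
  assumes V_eq: "V = K \<union> L \<union> M"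
    and disjoint: "K \<inter> L = {}" "K \<inter> M = {}" "L \<inter> M = {}"
    and \<sigma>_closed: "x \<in> K \<Longrightarrow> \<sigma> x \<in> K" "x \<in> L \<Longrightarrow> \<sigma> x \<in> L" "x \<in> M \<Longrightarrow> \<sigma> x \<in> M"
    and odd_V: "odd (card V)"
    and \<rho>_K: "\<rho> ` K = K"
    and \<rho>_eq: "x \<notin> K \<Longrightarrow> \<rho> x = \<sigma> x"
    and \<rho>_step: "x \<in> K \<Longrightarrow> x \<noteq> c \<Longrightarrow> \<rho> x = \<sigma> x \<or> \<sigma> (\<rho> x) = x"
    and c: "c \<in> K" "\<rho> c = c"
    and m: "m \<in> M"
    and Y: "Y \<subseteq> L" "card Y = 2"
begin

lemma \<rho>_in_K: "x \<in> K \<Longrightarrow> \<rho> x \<in> K"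
  using imageI[of x K \<rho>] unfolding \<rho>_K .

lemma \<rho>_preimage:
  assumes "x \<in> K"
  obtains y where "y \<in> K" "\<rho> y = x"
proof -
  have "x \<in> \<rho> ` K" using assms unfolding \<rho>_K .
  then show thesis using that by blast
qed

text \<open>Distinct non-adjacent vertices are consecutive on a cycle, and each of the three parts
  is closed under \<open>\<sigma>\<close>.\<close>

lemma adj_cross:
  assumes "(x \<in> K \<and> y \<in> L \<union> M) \<or> (x \<in> L \<and> y \<in> K \<union> M) \<or> (x \<in> M \<and> y \<in> K \<union> L)"
  shows "adj x y"
proof -
  have V: "K \<subseteq> V" "L \<subseteq> V" "M \<subseteq> V" by (auto simp: V_eq)
  have cross: "adj x y"
    if "x \<in> A" "\<sigma> x \<in> A" "y \<in> B" "\<sigma> y \<in> B" "A \<inter> B = {}" "A \<subseteq> V" "B \<subseteq> V" for A B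
    using that by (auto simp: adj_def)
  have "adj x y" if "x \<in> K" "y \<in> L" using that cross[of K L] disjoint V \<sigma>_closed by simp
  moreover have "adj x y" if "x \<in> K" "y \<in> M" using that cross[of K M] disjoint V \<sigma>_closed by simp
  moreover have "adj x y" if "x \<in> L" "y \<in> K" using that cross[of L K] disjoint V \<sigma>_closed by auto
  moreover have "adj x y" if "x \<in> L" "y \<in> M" using that cross[of L M] disjoint V \<sigma>_closed by simp
  moreover have "adj x y" if "x \<in> M" "y \<in> K" using that cross[of M K] disjoint V \<sigma>_closed by auto
  moreover have "adj x y" if "x \<in> M" "y \<in> L" using that cross[of M L] disjoint V \<sigma>_closed by auto
  ultimately show ?thesis using assms by blast
qed

section \<open>The auxiliary graph on pairs of positions\<close>

definition shadow :: "'a \<Rightarrow> 'a \<Rightarrow> 'a" where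
  "shadow x y = (if y \<in> Y then \<rho> x else \<sigma> x)"

text \<open>A state is a pair of simultaneous positions. A vertex \<open>x\<close> outside
  \<open>K\<close> occurs only in the state \<open>(x, \<sigma> x)\<close>; a vertex of
  \<open>K\<close> may also occur in \<open>(x, \<rho> x)\<close>.\<close>

definition state_edge :: "'a \<Rightarrow> 'a \<Rightarrow> ('a \<times> 'a) set" where
  "state_edge x y = {(x, shadow x y), (y, shadow y x)}"

definition state_edges :: "('a \<times> 'a) set set" where
  "state_edges = {state_edge x y | x y. adj x y}"

lemma state_edge_sym: "state_edge x y = state_edge y x"
  by (auto simp: state_edge_def)

lemma finite_state_edges: "finite state_edges"
proof -
  have "state_edges = (\<lambda>(x, y). state_edge x y) ` parcs G"
    unfolding state_edges_def parcs_G by (rule image_pairs)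
  moreover have "finite (parcs G)"
    using pair_graph_G by (simp add: pair_graph_def pair_digraph_def pair_fin_digraph_def
      pair_fin_digraph_axioms_def)
  ultimately show ?thesis by simp
qed

lemma card_state_edge: "e \<in> state_edges \<Longrightarrow> card e = 2"
  by (auto simp: state_edges_def state_edge_def adj_def)

section \<open>Both projections are bijections between edge sets\<close>

lemma fst_state_edge: "fst ` state_edge x y = {x, y}"
  by (simp add: state_edge_def)

lemma snd_state_edge: "snd ` state_edge x y = {shadow x y, shadow y x}"
  by (simp add: state_edge_def)

lemma inj_fst: "inj_on ((`) fst) state_edges"
proof (rule inj_onI)
  fix e e' assume "e \<in> state_edges" "e' \<in> state_edges" "fst ` e = fst ` e'"
  then obtain x y x' y' where *: "e = state_edge x y" "e' = state_edge x' y'" "{x, y} = {x', y'}"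
    by (auto simp: state_edges_def fst_state_edge)
  then have "x = x' \<and> y = y' \<or> x = y' \<and> y = x'" by (auto simp: doubleton_eq_iff)
  with * show "e = e'" by (auto simp: state_edge_sym)
qed

lemma image_fst: "((`) fst) ` state_edges = uedges G"
proof -
  have "((`) fst) ` state_edges = {fst ` state_edge x y | x y. adj x y}"
    unfolding state_edges_def by blast
  then show ?thesis unfolding uedges_G fst_state_edge .
qed

lemma not_in_K: "x \<in> L \<Longrightarrow> x \<notin> K" "x \<in> M \<Longrightarrow> x \<notin> K" "y \<in> Y \<Longrightarrow> y \<notin> K" "y \<in> Y \<Longrightarrow> y \<in> L"
    "x \<in> K \<Longrightarrow> x \<notin> Y" "x \<in> M \<Longrightarrow> x \<notin> Y"
  using disjoint Y by auto

lemma shadow_eq: "x \<notin> K \<or> y \<notin> Y \<Longrightarrow> shadow x y = \<sigma> x"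
  by (auto simp: shadow_def \<rho>_eq)

lemma shadow_K_Y:
  assumes "x \<in> K" "y \<in> Y"
  shows "shadow x y = \<rho> x" "shadow y x = \<sigma> y"
proof -
  show "shadow x y = \<rho> x" using assms(2) by (simp add: shadow_def)
  have "y \<notin> K" using assms(2) by (rule not_in_K)
  then show "shadow y x = \<sigma> y" by (simp add: shadow_eq)
qed

text \<open>Either both ends move by the automorphism \<open>\<sigma>\<close>, or the edge joins
  \<open>K\<close> to \<open>Y\<close> and its shadow still joins \<open>K\<close> to
  \<open>L\<close>.\<close>

lemma adj_shadow:
  assumes "adj x y"
  shows "adj (shadow x y) (shadow y x)"
proof -
  have cross: "adj (shadow x y) (shadow y x)" if "x \<in> K" "y \<in> Y" for x y
  proof -
    have "\<rho> x \<in> K" "\<sigma> y \<in> L" using that \<rho>_in_K \<sigma>_closed(2) not_in_K(4) by blast+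
    then show ?thesis unfolding shadow_K_Y[OF that] by (intro adj_cross) blast
  qed
  consider "x \<in> K" "y \<in> Y" | "y \<in> K" "x \<in> Y" | "x \<notin> K \<or> y \<notin> Y" "y \<notin> K \<or> x \<notin> Y" by blast
  then show ?thesis
  proof cases
    case 1
    then show ?thesis by (rule cross)
  next
    case 2
    then show ?thesis by (intro adj_sym[OF cross])
  next
    case 3
    then show ?thesis
      using assms adj_\<sigma>_iff[OF adj_in_V[OF assms]] by (simp add: shadow_eq)
  qed
qed

text \<open>Both ends are pulled back along \<open>\<sigma>\<close>, unless one lies in
  \<open>K\<close> and the other in the image of \<open>Y\<close>: then the end in \<open>K\<close>
  is pulled back along \<open>\<rho>\<close>.\<close>

lemma shadow_surj:
  assumes "adj a b"
  obtains x y where "adj x y" "{shadow x y, shadow y x} = {a, b}"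
proof -
  have cross: "\<exists>x y. adj x y \<and> shadow x y = a \<and> shadow y x = b"
    if "a \<in> K" "y \<in> Y" "b = \<sigma> y" for a b y
  proof -
    obtain x where "x \<in> K" "\<rho> x = a" by (rule \<rho>_preimage[OF \<open>a \<in> K\<close>])
    moreover have "adj x y"
      using \<open>x \<in> K\<close> not_in_K(4)[OF \<open>y \<in> Y\<close>] by (intro adj_cross) blast
    ultimately show ?thesis using shadow_K_Y[of x y] that by blast
  qed
  obtain x y where xy: "x \<in> V" "a = \<sigma> x" "y \<in> V" "b = \<sigma> y"
    using adj_in_V[OF assms] \<sigma>_preimage by metis
  then have "adj x y" using assms adj_\<sigma>_iff by simp
  consider "a \<in> K" "y \<in> Y" | "b \<in> K" "x \<in> Y" | "x \<notin> K \<or> y \<notin> Y" "y \<notin> K \<or> x \<notin> Y"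
    using xy \<sigma>_closed(1)[of x] \<sigma>_closed(1)[of y] by blast
  then show thesis
  proof cases
    case 1
    then show thesis using cross[of a y b] xy that by blast
  next
    case 2
    then show thesis using cross[of b x a] xy that by blast
  next
    case 3
    then show thesis using \<open>adj x y\<close> xy that[of x y] shadow_eq by simp
  qed
qed

lemma image_snd: "((`) snd) ` state_edges = uedges G"
proof
  show "((`) snd) ` state_edges \<subseteq> uedges G"
  proof
    fix e assume "e \<in> ((`) snd) ` state_edges"
    then obtain x y where "adj x y" "e = snd ` state_edge x y"
      unfolding state_edges_def by blast
    then show "e \<in> uedges G"
      using adj_shadow unfolding uedges_G snd_state_edge by blast
  qed
  show "uedges G \<subseteq> ((`) snd) ` state_edges"
  proof
    fix e assume "e \<in> uedges G"
    then obtain a b where "e = {a, b}" "adj a b" unfolding uedges_G by blast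
    from shadow_surj[OF this(2)] this(1) obtain x y where "adj x y" "snd ` state_edge x y = e"
      by (metis snd_state_edge)
    then show "e \<in> ((`) snd) ` state_edges" unfolding state_edges_def by blast
  qed
qed

text \<open>By counting: the second projection maps onto a set which, by the first projection, has
  as many elements as \<open>state_edges\<close>.\<close>

lemma inj_snd: "inj_on ((`) snd) state_edges"
proof (rule eq_card_imp_inj_on[OF finite_state_edges])
  show "card (((`) snd) ` state_edges) = card state_edges"
    using card_image[OF inj_fst] unfolding image_snd image_fst by simp
qed

section \<open>Degrees of states\<close>

lemma card_state_edges_at:
  "card {e \<in> state_edges. (x, z) \<in> e} = card {y. adj x y \<and> shadow x y = z}"
proof -
  have "{e \<in> state_edges. (x, z) \<in> e} = state_edge x ` {y. adj x y \<and> shadow x y = z}"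
  proof (intro equalityI subsetI)
    fix e assume "e \<in> {e \<in> state_edges. (x, z) \<in> e}"
    then obtain a b where *: "e = state_edge a b" "adj a b" "(x, z) \<in> state_edge a b"
      by (auto simp: state_edges_def)
    then consider "a = x" "shadow x b = z" | "b = x" "shadow x a = z"
      by (auto simp: state_edge_def)
    then show "e \<in> state_edge x ` {y. adj x y \<and> shadow x y = z}"
      using * state_edge_sym adj_sym by cases auto
  qed (auto simp: state_edges_def state_edge_def)
  moreover have "inj_on (state_edge x) {y. adj x y \<and> shadow x y = z}"
  proof (rule inj_onI)
    fix y y' assume "state_edge x y = state_edge x y'"
    then have "{x, y} = {x, y'}" by (metis fst_state_edge)
    then show "y = y'" by (auto simp: doubleton_eq_iff)
  qed
  ultimately show ?thesis by (simp add: card_image)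
qed

lemma finite_Y: "finite Y"
  using Y(2) card.infinite by fastforce

lemma adj_Y: "x \<in> K \<Longrightarrow> y \<in> Y \<Longrightarrow> adj x y"
  using Y adj_cross by blast

text \<open>The possible degrees are \<open>card V - 3\<close>, \<open>card V - 3 - 2\<close>, 2 and
  0. The deviation from \<open>\<sigma>\<close> moves exactly the two edges towards \<open>Y\<close>
  to another state, which preserves parity.\<close>

lemma even_degree: "even (card {e \<in> state_edges. s \<in> e})"
proof -
  obtain x z where s: "s = (x, z)" by force
  let ?N = "{y. adj x y \<and> shadow x y = z}"
  consider "x \<notin> V" | "x \<in> V" "z = \<sigma> x" "\<rho> x = \<sigma> x" | "x \<in> V" "z = \<sigma> x" "\<rho> x \<noteq> \<sigma> x"
    | "x \<in> V" "z \<noteq> \<sigma> x" "z = \<rho> x" | "x \<in> V" "z \<noteq> \<sigma> x" "z \<noteq> \<rho> x" by blast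
  then have "even (card ?N)"
  proof cases
    case 1
    then have "?N = {}" using adj_in_V by blast
    then show ?thesis by (metis card.empty even_zero)
  next
    case 2
    then have "?N = {y. adj x y}" by (auto simp: shadow_def)
    then show ?thesis using card_neighbours[OF 2(1)] odd_V by auto
  next
    case 3
    then have "x \<in> K" using \<rho>_eq by blast
    have "?N = {y. adj x y} - Y" using 3 by (auto simp: shadow_def)
    moreover have "Y \<subseteq> {y. adj x y}" using adj_Y[OF \<open>x \<in> K\<close>] by blast
    ultimately have "card ?N = card V - 3 - 2"
      using card_neighbours[OF 3(1)] Y finite_Y by (simp add: card_Diff_subset)
    then show ?thesis using odd_V by auto
  next
    case 4
    then have "x \<in> K" using \<rho>_eq by blast
    then have "?N = Y" using 4 adj_Y by (auto simp: shadow_def)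
    then show ?thesis using Y by simp
  next
    case 5
    then have "?N = {}" by (auto simp: shadow_def)
    then show ?thesis by (metis card.empty even_zero)
  qed
  then show ?thesis unfolding s card_state_edges_at .
qed

lemma c_in_V: "c \<in> V"
  using c V_eq by blast

text \<open>Degree two means that a closed trail starting here uses up all edges at
  \<open>(c, c)\<close> by leaving and returning once.\<close>

lemma card_state_edges_start: "card {e \<in> state_edges. (c, c) \<in> e} = 2"
proof -
  have "{y. adj c y \<and> shadow c y = c} = Y"
    using adj_Y c \<sigma>_neq[OF c_in_V] by (auto simp: shadow_def)
  then show ?thesis unfolding card_state_edges_at using Y by simp
qed

text \<open>Every state edge is linked to the one between \<open>m\<close> and \<open>y0\<close>, by
  moving along edges that share a state.\<close>

lemma state_edges_connected:
  assumes A: "A \<subseteq> state_edges" "A \<noteq> {}"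
    and closed: "\<And>e e'. e \<in> A \<Longrightarrow> e' \<in> state_edges \<Longrightarrow> e \<inter> e' \<noteq> {} \<Longrightarrow> e' \<in> A"
  shows "state_edges \<subseteq> A"
proof -
  obtain y0 where y0: "y0 \<in> Y" using Y(2) by fastforce
  let ?a = "\<lambda>x y. state_edge x y \<in> A"
  have sym: "?a x y \<longleftrightarrow> ?a y x" for x y by (simp add: state_edge_sym)
  have step: "?a x y \<longleftrightarrow> ?a x y'" if "adj x y" "adj x y'" "shadow x y = shadow x y'" for x y y'
  proof -
    have "state_edge x y \<inter> state_edge x y' \<noteq> {}" "state_edge x y' \<inter> state_edge x y \<noteq> {}"
      using that by (auto simp: state_edge_def)
    moreover have "state_edge x y \<in> state_edges" "state_edge x y' \<in> state_edges"
      using that by (auto simp: state_edges_def)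
    ultimately show ?thesis using closed by blast
  qed
  have y0L: "y0 \<in> L" "y0 \<notin> K" and mY: "m \<notin> Y"
    using y0 m not_in_K by blast+
  \<comment> \<open>Two moves: replace \<open>y\<close> by \<open>y0\<close> at the state of
    \<open>x\<close>, then \<open>x\<close> by \<open>m\<close> at the state of \<open>y0\<close>.
    Both states are unique because \<open>x\<close> and \<open>y0\<close> lie outside
    \<open>K\<close>.\<close>
  have M: "?a x y \<longleftrightarrow> ?a m y0" if "x \<in> M" "adj x y" for x y
  proof -
    have "x \<notin> Y" "x \<notin> K" using that(1) not_in_K by blast+
    have "adj x y0" "adj y0 x" "adj y0 m" using that(1) m y0L(1) by (blast intro: adj_cross)+
    have "?a x y \<longleftrightarrow> ?a x y0"
      by (rule step) (use \<open>adj x y\<close> \<open>adj x y0\<close> \<open>x \<notin> K\<close> in \<open>simp_all add: shadow_eq\<close>)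
    also have "\<dots> \<longleftrightarrow> ?a y0 m"
      unfolding sym[of x]
      by (rule step) (use \<open>adj y0 x\<close> \<open>adj y0 m\<close> y0L in \<open>simp_all add: shadow_eq\<close>)
    finally show ?thesis unfolding sym[of m] .
  qed
  \<comment> \<open>Since \<open>m\<close> is not in \<open>Y\<close>, the edge towards
    \<open>m\<close> leaves from \<open>(x, \<sigma> x)\<close>, as does the given edge.\<close>
  have to_m: "?a x y \<longleftrightarrow> ?a m y0" if "x \<in> K \<union> L" "x \<notin> K \<or> y \<notin> Y" "adj x y" for x y
  proof -
    have "adj x m" "adj m x" using that(1) m by (blast intro: adj_cross)+
    have "?a x y \<longleftrightarrow> ?a x m"
      by (rule step) (use that \<open>adj x m\<close> mY in \<open>simp_all add: shadow_eq\<close>)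
    also have "\<dots> \<longleftrightarrow> ?a m y0"
      unfolding sym[of x] using M[OF m \<open>adj m x\<close>] .
    finally show ?thesis .
  qed
  have L: "?a x y \<longleftrightarrow> ?a m y0" if "x \<in> L" "adj x y" for x y
    using to_m[of x y] that not_in_K(1)[of x] by blast
  have K: "?a x y \<longleftrightarrow> ?a m y0" if "x \<in> K" "y \<in> K" "adj x y" for x y
    using to_m[of x y] that not_in_K(5)[of y] by blast
  \<comment> \<open>Edges between \<open>K\<close> and \<open>Y\<close>, which \<open>to_m\<close>
    does not cover from \<open>K\<close>, are treated from their end in \<open>L\<close>.\<close>
  have all: "?a x y \<longleftrightarrow> ?a m y0" if xy: "adj x y" for x y
  proof -
    consider "x \<in> K" "y \<in> K" | "x \<in> L" | "x \<in> M" | "y \<in> L" | "y \<in> M"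
      using adj_in_V[OF xy] V_eq by auto
    then show ?thesis
      using K[OF _ _ xy] L[OF _ xy] M[OF _ xy] L[OF _ adj_sym[OF xy]]
        M[OF _ adj_sym[OF xy]] sym[of x y] by cases simp_all
  qed
  obtain e where "e \<in> A" "e \<in> state_edges" using A by blast
  then obtain x y where "adj x y" "?a x y" unfolding state_edges_def by blast
  then show ?thesis using all by (auto simp: state_edges_def)
qed

section \<open>Projecting a closed trail of states to circuits\<close>

lemma walk_edges_map: "walk_edges (map f p) = map ((`) f) (walk_edges p)"
  by (induction p rule: vwalk_arcs.induct) (auto simp: uedge_def)

text \<open>A projection that is bijective on edges keeps them distinct and covers all of
  \<open>uedges G\<close>. Stated for \<open>f\<close> to serve both coordinates.\<close>

lemma eulerian_circuit_map:
  assumes p: "trail_in state_edges p" "hd p = (c, c)" "last p = (c, c)"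
      "set (walk_edges p) = state_edges"
    and f: "inj_on ((`) f) state_edges" "((`) f) ` state_edges = uedges G" "f (c, c) = c"
  shows "eulerian_circuit G c (map f p)"
proof -
  let ?q = "map f p"
  have ne: "p \<noteq> []" using p by (simp add: trail_in_def)
  have set_q: "set (walk_edges ?q) = uedges G"
    unfolding walk_edges_map set_map[of "(`) f" "walk_edges p"] p(4) f(2) ..
  have dist: "distinct (walk_edges ?q)"
    unfolding walk_edges_map distinct_map[of "(`) f" "walk_edges p"] p(4)
    using p(1) f(1) unfolding trail_in_def by blast
  have arcs: "set (vwalk_arcs ?q) \<subseteq> parcs G"
  proof
    fix e assume e: "e \<in> set (vwalk_arcs ?q)"
    then have "uedge e \<in> uedges G" using set_q by auto
    then obtain x y where "uedge e = {x, y}" "adj x y" unfolding uedges_G by blast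
    then have "e = (x, y) \<or> e = (y, x)"
      by (cases e) (auto simp: uedge_def doubleton_eq_iff)
    then show "e \<in> parcs G" using \<open>adj x y\<close> adj_sym by (auto simp: parcs_G)
  qed
  have "uedges G \<noteq> {}"
    using adj_cross[of c m] c m unfolding uedges_G by blast
  then have "walk_edges ?q \<noteq> []" using set_q by auto
  then have "length ?q \<ge> 2" using length_walk_edges[of ?q] by (cases "length ?q \<ge> 2") auto
  then have "set ?q \<subseteq> \<Union>(uedges G)"
    using subset_Union_walk_edges[of ?q] set_q by simp
  also have "\<dots> \<subseteq> V" using adj_in_V by (auto simp: uedges_G)
  finally have "set ?q \<subseteq> V" .
  then show ?thesis
    using arcs dist set_q ne p f
    by (simp add: eulerian_circuit_def closed_trail_def vwalk_def hd_map last_map)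
qed

text \<open>An interior visit would put \<open>(c, c)\<close> on three distinct edges: the first,
  the last and the one leaving position \<open>i\<close>.\<close>

lemma interior_states:
  assumes p: "trail_in state_edges p" "hd p = (c, c)" "last p = (c, c)"
      "set (walk_edges p) = state_edges"
    and i: "0 < i" "Suc i < length p"
  shows "p ! i \<noteq> (c, c)"
proof
  assume pi: "p ! i = (c, c)"
  let ?es = "walk_edges p" and ?k = "length p - 2"
  have ne: "p \<noteq> []" using p by (simp add: trail_in_def)
  have len: "length ?es = length p - 1" by (rule length_walk_edges)
  have in_F: "?es ! j \<in> state_edges" if "Suc j < length p" for j
    using that len p(4) nth_mem[of j ?es] by simp
  have "Suc ?k = length p - 1" using i by arith
  then have p0: "p ! 0 = (c, c)" "p ! Suc ?k = (c, c)"
    using p(2,3) hd_conv_nth[OF ne] last_conv_nth[OF ne] by simp_all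
  have "card (?es ! 0) = 2" "card (?es ! ?k) = 2" using in_F i card_state_edge by auto
  \<comment> \<open>\<open>?k\<close> is the index of the last edge; equality would make that edge a
    loop at \<open>(c, c)\<close>.\<close>
  then have "i \<noteq> ?k"
    using p0 pi walk_edges_nth[of ?k p] i by auto
  have at_c: "(c, c) \<in> ?es ! 0" "(c, c) \<in> ?es ! i" "(c, c) \<in> ?es ! ?k"
    using p0 pi i walk_edges_nth[of 0 p] walk_edges_nth[of i p] walk_edges_nth[of ?k p] by auto
  have "{?es ! 0, ?es ! i, ?es ! ?k} \<subseteq> {e \<in> state_edges. (c, c) \<in> e}"
    using at_c in_F[of 0] in_F[of i] in_F[of ?k] i by auto
  then have "card {?es ! 0, ?es ! i, ?es ! ?k} \<le> 2"
    using card_mono[of "{e \<in> state_edges. (c, c) \<in> e}"] finite_state_edges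
      card_state_edges_start by simp
  moreover have distinct: "?es ! j \<noteq> ?es ! k" if "j < k" "Suc k < length p" for j k
  proof -
    have "distinct ?es" using p(1) unfolding trail_in_def by blast
    moreover have "j < length ?es" "k < length ?es" using that unfolding len by arith+
    ultimately show ?thesis using nth_eq_iff_index_eq \<open>j < k\<close> by blast
  qed
  have "?es ! 0 \<noteq> ?es ! i" "?es ! i \<noteq> ?es ! ?k" "?es ! 0 \<noteq> ?es ! ?k"
    using \<open>i \<noteq> ?k\<close> i by (intro distinct; arith)+
  then have "card {?es ! 0, ?es ! i, ?es ! ?k} = 3" by simp
  ultimately show False by simp
qed

text \<open>Away from \<open>(c, c)\<close>, both \<open>\<sigma>\<close> and \<open>\<rho>\<close>
  lead from \<open>x\<close> to one of its cycle neighbours, which are non-neighbours in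
  \<open>G\<close>.\<close>

lemma state_avoiding:
  assumes "(x, z) \<in> \<Union>state_edges" "(x, z) \<noteq> (c, c)"
  shows "x \<noteq> z \<and> (x, z) \<notin> parcs G"
proof -
  obtain y where "adj x y" "z = shadow x y"
    using assms(1) adj_sym by (auto simp: state_edges_def state_edge_def)
  then have "x \<in> V" "z = \<sigma> x \<or> \<sigma> z = x"
    using assms(2) adj_in_V \<rho>_eq[of x] \<rho>_step[of x] c unfolding shadow_def by metis+
  then show ?thesis using \<sigma>_neq[of x] by (auto simp: parcs_G adj_def)
qed

theorem avoiding_circuits:
  obtains p q where "eulerian_circuit G c p" "eulerian_circuit G c q" "avoiding G p q"
proof -
  have "{e \<in> state_edges. (c, c) \<in> e} \<noteq> {}"
    using card_state_edges_start by (metis card.empty zero_neq_numeral)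
  then have start: "(c, c) \<in> \<Union>state_edges" by blast
  obtain p where p: "trail_in state_edges p" "hd p = (c, c)" "last p = (c, c)"
      "set (walk_edges p) = state_edges"
  proof (rule even_degree_closed_trail[OF finite_state_edges _ even_degree _ start])
    fix A :: "('a \<times> 'a) set set"
    assume "A \<subseteq> state_edges" "A \<noteq> {}"
      "\<And>e e'. e \<in> A \<Longrightarrow> e' \<in> state_edges \<Longrightarrow> e \<inter> e' \<noteq> {} \<Longrightarrow> e' \<in> A"
    then show "state_edges \<subseteq> A" by (rule state_edges_connected)
  qed (simp_all add: card_state_edge)
  have fst: "eulerian_circuit G c (map fst p)"
    using eulerian_circuit_map[OF p inj_fst image_fst] by simp
  have snd: "eulerian_circuit G c (map snd p)"
    using eulerian_circuit_map[OF p inj_snd image_snd] by simp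
  have len: "length p = card (uedges G) + 1"
    using eulerian_circuit_length[OF fst] by simp
  have "avoiding G (map fst p) (map snd p)"
    unfolding avoiding_def
  proof
    \<comment> \<open>The list \<open>p\<close> has one entry more than there are edges, so these
      indices are exactly its interior positions.\<close>
    fix i assume "i \<in> {1..card (uedges G) - 1}"
    then have i: "0 < i" "Suc i < length p" using len by auto
    then have "p ! i \<in> set p" "length p \<ge> 2" by simp_all
    then have "p ! i \<in> \<Union>state_edges"
      using subsetD[OF subset_Union_walk_edges] unfolding p(4)[symmetric] by metis
    moreover have "p ! i \<noteq> (c, c)" using interior_states[OF p i] .
    ultimately show "map fst p ! i \<noteq> map snd p ! i \<and> (map fst p ! i, map snd p ! i) \<notin> parcs G"
      using state_avoiding[of "fst (p ! i)" "snd (p ! i)"] i by simp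
  qed
  with fst snd show thesis by (rule that)
qed

text \<open>Vertices outside \<open>M\<close> are adjacent to \<open>m\<close>; those in
  \<open>M\<close> reach it through \<open>c\<close>.\<close>

lemma connected_G: "connected (with_proj G)"
proof -
  have arc: "(x, y) \<in> (arcs_ends (with_proj G))\<^sup>s" if "adj x y" for x y
    using that by (simp add: parcs_G symcl_def)
  let ?R = "rtrancl_on V ((arcs_ends (with_proj G))\<^sup>s)"
  have edge: "(x, y) \<in> ?R" if "adj x y" for x y
    using arc[OF that] adj_in_V[OF that] by (meson rtrancl_on_into_rtrancl_on rtrancl_on_refl)
  have to_m: "(x, m) \<in> ?R \<and> (m, x) \<in> ?R" if "x \<in> V" for x
  proof (cases "x \<in> M")
    case False
    then have "x \<in> K \<union> L" using that V_eq by auto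
    then have "adj x m" "adj m x" using m by (auto intro!: adj_cross)
    then show ?thesis using edge by blast
  next
    case True
    then have "adj x c" "adj c m" "adj m c" "adj c x" using m c by (auto intro!: adj_cross)
    then show ?thesis using edge by (meson rtrancl_on_trans)
  qed
  then have "(x, y) \<in> ?R" if "x \<in> V" "y \<in> V" for x y
    using that by (meson rtrancl_on_trans)
  then show ?thesis
    unfolding connected_conv using c_in_V by auto
qed

end

section \<open>Two triangles and a long cycle\<close>

text \<open>Without \<open>c\<close>, the odd cycle is a path with an even number of vertices;
  \<open>\<rho>\<close> swaps the partners in its perfect matching.\<close>

lemma odd_cycle_almost_matching:
  fixes a l c :: nat
  assumes l: "odd l" and c: "a \<le> c" "c < a + l"
    and \<sigma>: "\<And>x. a \<le> x \<Longrightarrow> x < a + l \<Longrightarrow> \<sigma> x = (if Suc x = a + l then a else Suc x)"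
  obtains \<rho> where "\<rho> ` {a..<a + l} = {a..<a + l}" "\<And>x. x \<notin> {a..<a + l} \<Longrightarrow> \<rho> x = \<sigma> x"
    "\<And>x. x \<in> {a..<a + l} \<Longrightarrow> x \<noteq> c \<Longrightarrow> \<rho> x = \<sigma> x \<or> \<sigma> (\<rho> x) = x" "\<rho> c = c"
proof -
  \<comment> \<open>Pairs are formed consecutively from the successor of \<open>c\<close> on, and
    \<open>fwd\<close> marks the first vertex of each. Below \<open>c\<close> the parity flips, as
    the distance from \<open>c\<close> along the cycle is then \<open>x + l - c\<close> with
    \<open>l\<close> odd.\<close>
  define fwd where "fwd x \<longleftrightarrow> (odd (x + c) \<longleftrightarrow> c < x)" for x
  define \<tau> where "\<tau> x = (if x = c then c
      else if fwd x then (if Suc x = a + l then a else Suc x)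
      else (if x = a then a + l - 1 else x - 1))" for x
  have in_K: "\<tau> x \<in> {a..<a + l}" if "x \<in> {a..<a + l}" for x
    using that c by (auto simp: \<tau>_def)
  have invol: "\<tau> (\<tau> x) = x" if x: "x \<in> {a..<a + l}" for x
  proof (cases "x = c")
    case False
    show ?thesis
    proof (cases "fwd x")
      case True
      \<comment> \<open>The partner of a forward vertex is a backward one; at the wrap-around this
        uses that \<open>l\<close> is odd.\<close>
      then have "\<tau> x \<noteq> c \<and> \<not> fwd (\<tau> x)"
        using False x c l unfolding \<tau>_def fwd_def by (auto split: if_splits) presburger+
      then show ?thesis using True False x by (auto simp: \<tau>_def split: if_splits)
    next
      case nf: False
      then have "\<tau> x \<noteq> c \<and> fwd (\<tau> x)"
        using False x c l unfolding \<tau>_def fwd_def by (auto split: if_splits) presburger+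
      then show ?thesis using nf False x by (auto simp: \<tau>_def split: if_splits)
    qed
  qed (simp add: \<tau>_def)
  have surj: "\<tau> ` {a..<a + l} = {a..<a + l}"
    using in_K invol by (metis (no_types, lifting) image_subset_iff image_iff subsetI subset_antisym)
  let ?\<rho> = "\<lambda>x. if x \<in> {a..<a + l} then \<tau> x else \<sigma> x"
  show thesis
  proof (rule that[of ?\<rho>])
    show "?\<rho> ` {a..<a + l} = {a..<a + l}" using surj by simp
    fix x assume x: "x \<in> {a..<a + l}" "x \<noteq> c"
    then have "\<sigma> (\<tau> x) = x" if "\<not> fwd x"
      using that in_K[OF x(1)] \<sigma>[of "\<tau> x"] by (auto simp: \<tau>_def)
    moreover have "\<tau> x = \<sigma> x" if "fwd x"
      using that x \<sigma>[of x] by (auto simp: \<tau>_def)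
    ultimately show "?\<rho> x = \<sigma> x \<or> \<sigma> (?\<rho> x) = x" using x by auto
  qed (use c in \<open>auto simp: \<tau>_def\<close>)
qed

theorem theorem2:
  fixes n :: nat
  assumes "odd n" and "n \<ge> 9"
  shows "\<exists>G :: nat pair_pre_digraph.
           doubly_eulerian G \<and> card (pverts G) = n \<and> regular_of_degree G (n - 3)"
proof -
  \<comment> \<open>The cycles are 0, 1, 2 and 3, 4, 5 and 6, ..., \<open>n - 1\<close>; the last
    has odd length at least 3 because \<open>n\<close> is odd and at least 9.\<close>
  define \<sigma> :: "nat \<Rightarrow> nat" where
    "\<sigma> x = (if x = 2 then 0 else if x = 5 then 3 else if Suc x = n then 6 else Suc x)" for x
  have inj: "inj_on \<sigma> {..<n}"
    using assms by (auto simp: inj_on_def \<sigma>_def split: if_splits)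
  interpret cycle_union "{..<n}" \<sigma>
  proof
    show "\<sigma> ` {..<n} = {..<n}"
      by (rule endo_inj_surj[OF _ _ inj]) (use assms in \<open>auto simp: \<sigma>_def\<close>)
    show "\<sigma> x \<noteq> x" if "x \<in> {..<n}" for x
      using that assms by (auto simp: \<sigma>_def)
    show "\<sigma> (\<sigma> x) \<noteq> x" if "x \<in> {..<n}" for x
      using that assms by (auto simp: \<sigma>_def)
  qed (simp_all add: inj)
  have seam: "\<exists>\<rho>. seam {..<n} \<sigma> K L M \<rho> c m Y"
    if K: "K = {a..<a + l}" "odd l" "c \<in> K"
        "\<And>x. x \<in> K \<Longrightarrow> \<sigma> x = (if Suc x = a + l then a else Suc x)"
      and parts: "{..<n} = K \<union> L \<union> M" "K \<inter> L = {}" "K \<inter> M = {}" "L \<inter> M = {}"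
        "\<And>x. x \<in> K \<Longrightarrow> \<sigma> x \<in> K" "\<And>x. x \<in> L \<Longrightarrow> \<sigma> x \<in> L" "\<And>x. x \<in> M \<Longrightarrow> \<sigma> x \<in> M"
        "m \<in> M" "Y \<subseteq> L" "card Y = 2"
    for K L M Y :: "nat set" and a l c m
  proof -
    obtain \<rho> where \<rho>: "\<rho> ` K = K" "\<And>x. x \<notin> K \<Longrightarrow> \<rho> x = \<sigma> x"
      "\<And>x. x \<in> K \<Longrightarrow> x \<noteq> c \<Longrightarrow> \<rho> x = \<sigma> x \<or> \<sigma> (\<rho> x) = x" "\<rho> c = c"
      using odd_cycle_almost_matching[of l a c \<sigma>] K by auto
    have "seam {..<n} \<sigma> K L M \<rho> c m Y"
      by unfold_locales (fact \<rho> K parts | simp add: assms)+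
    then show ?thesis by blast
  qed
  let ?A = "{0..<3::nat}" and ?B = "{3..<6::nat}" and ?C = "{6..<n}"
  have closed: "x \<in> ?A \<Longrightarrow> \<sigma> x \<in> ?A" "x \<in> ?B \<Longrightarrow> \<sigma> x \<in> ?B" "x \<in> ?C \<Longrightarrow> \<sigma> x \<in> ?C" for x
    using assms by (auto simp: \<sigma>_def)
  \<comment> \<open>\<open>K\<close> has to be the cycle through \<open>c\<close>; the other two
    become \<open>L\<close> and \<open>M\<close>, with \<open>L\<close> always a triangle containing
    \<open>Y\<close>.\<close>
  have ex_seam: "\<exists>K L M \<rho> m Y. seam {..<n} \<sigma> K L M \<rho> c m Y" if c: "c < n" for c
  proof -
    consider "c \<in> ?A" | "c \<in> ?B" | "c \<in> ?C" using c by fastforce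
    then show ?thesis
    proof cases
      case 1
      then have "\<exists>\<rho>. seam {..<n} \<sigma> ?A ?B ?C \<rho> c 6 {3, 4}"
        using assms closed by (intro seam[of _ 0 3]) (auto simp: \<sigma>_def)
      then show ?thesis by blast
    next
      case 2
      then have "\<exists>\<rho>. seam {..<n} \<sigma> ?B ?A ?C \<rho> c 6 {0, 1}"
        using assms closed by (intro seam[of _ 3 3]) (auto simp: \<sigma>_def)
      then show ?thesis by blast
    next
      case 3
      then have "\<exists>\<rho>. seam {..<n} \<sigma> ?C ?A ?B \<rho> c 3 {0, 1}"
        using assms closed by (intro seam[of _ 6 "n - 6"]) (auto simp: \<sigma>_def)
      then show ?thesis by blast
    qed
  qed
  have circuits: "\<exists>p q. eulerian_circuit G c p \<and> eulerian_circuit G c q \<and> avoiding G p q"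
    if "c < n" for c
    using ex_seam[OF that] seam.avoiding_circuits by metis
  have "connected (with_proj G)"
    using ex_seam[of 0] assms seam.connected_G by fastforce
  moreover have "\<exists>p. eulerian_circuit G 0 p" "0 < n"
    using circuits[of 0] assms by auto
  ultimately have "doubly_eulerian G"
    using circuits pair_graph_G unfolding doubly_eulerian_def eulerian_def by auto
  then show ?thesis using regular_G by auto
qed

end
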